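(* Let $A$ be a Hurwitz algebra over a field $k$. The categories $\check{\mathscr{I}}(A)$ and $\mathscr{X}(A)$ are equivalent. An equivalence $\mathscr{F}_{A}:\check{\mathscr{I}}(A)\to\mathscr{X}(A)$ is given by $\mathscr{F}_{A}(A_{\alpha,\beta})=[\alpha,\beta]$ on objects and $\mathscr{F}_{A}(\varphi)=[\varphi]$ on morphisms.
   Context: All algebras are finite dimensional and not necessarily associative. A Hurwitz algebra over a field $k$ is a non-zero $k$-algebra $A$ with identity element, equipped with a quadratic form $n=n_A:A\to k$ (the norm) such that $n(ab)=n(a)n(b)$ for all $a,b\in A$ and the bilinear form $\langle x,y\rangle=n(x+y)-n(x)-n(y)$ is non-degenerate. For $a\in A$ put $\mathrm{L}_a(x)=ax$, $\mathrm{R}_a(x)=xa$. For $\alpha,\beta\in\mathrm{GL}(A)$, the principal isotope $A_{\alpha,\beta}=(A,\circ)$ is the vector space $A$ with multiplication $x\circ y=\alpha(x)\beta(y)$. $\check{\mathscr{I}}(A)$ is the groupoid whose objects are the algebras $A_{\alpha,\beta}$, $\alpha,\beta\in\mathrm{GL}(A)$, and whose morphisms are the algebra isomorphisms between them. $\mathrm{GO}(A)$ is the group of similitudes of $(A,n)$: invertible linear $\varphi:A\to A$ with $n(\varphi(x))=\mu(\varphi)n(x)$ for all $x\in A$, where $\mu(\varphi)\in k^\ast$ is a scalar independent of $x$. $\mathrm{G}(A)$ is the group of all $\varphi\in\mathrm{GO}(A)$ for which there exist $\varphi_1,\varphi_2\in\mathrm{GO}(A)$ with $\varphi(xy)=\varphi_1(x)\varphi_2(y)$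 for all $x,y\in A$; such $\varphi_1,\varphi_2$ are called a pair of triality components of $\varphi$, and they again lie in $\mathrm{G}(A)$. Let $\mathbb{I}$ denote the identity map, $\mathrm{PG}(A)=\mathrm{G}(A)/(k^\ast\mathbb{I})$ and $\mathrm{PGL}(A)=\mathrm{GL}(A)/(k^\ast\mathbb{I})$; square brackets denote classes. The nucleus $N(A)$ is the set of $a\in A$ such that $(xy)z=x(yz)$ whenever $x,y,z\in A$ and $a\in\{x,y,z\}$; $N(A)^\ast$ is its group of invertible elements. $X_A$ is the orbit set of the action of $N(A)^\ast$ on $\mathrm{PGL}(A)^2$ given by $w\cdot([\alpha],[\beta])=([\mathrm{R}_w^{-1}\alpha],[\mathrm{L}_w\beta])$, and $[\alpha,\beta]\in X_A$ denotes the orbit of $([\alpha],[\beta])$. The group $\mathrm{PG}(A)$ acts on $X_A$ by $[\varphi]\cdot[\alpha,\beta]=[\varphi_1\alpha\varphi^{-1},\varphi_2\beta\varphi^{-1}]$, where $\varphi_1,\varphi_2$ is any pair of triality components of $\varphi$ (the result does not depend on the choices). For a group $G$ acting on a set $X$, the groupoid of the action has object class $X$, and morphisms $x\to y$ are the elements $g\in G$ with $g\cdot x=y$. $\mathscr{X}(A)$ is the groupoid of the action of $\mathrm{PG}(A)$ on $X_A$ given by $[\varphi]\cdot[\alpha,\beta]=[\varphi_1\alpha\varphi^{-1},\varphi_2\beta\varphi^{-1}]$. *)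

theory Defs
  imports Complex_Main "HOL-Algebra.Group_Action"
begin

section \<open>Categories, functors and equivalences\<close>

text \<open>A category is given by its family of hom-sets. These need not be disjoint, so a morphism is
  an element \<open>f \<in> Hom C x y\<close> considered together with \<open>x\<close> and \<open>y\<close>; accordingly the arrow map of a
  functor takes source and target as additional arguments.\<close>

record ('o, 'm) hom_cat =
  Ob :: "'o set"
  Hom :: "'o \<Rightarrow> 'o \<Rightarrow> 'm set"
  Idt :: "'o \<Rightarrow> 'm"
  Cmp :: "'m \<Rightarrow> 'm \<Rightarrow> 'm"

locale category =
  fixes C :: "('o, 'm) hom_cat"
  assumes Idt_in_Hom: "x \<in> Ob C \<Longrightarrow> Idt C x \<in> Hom C x x"
    and Cmp_in_Hom: "\<lbrakk>x \<in> Ob C; y \<in> Ob C; z \<in> Ob C; f \<in> Hom C x y; g \<in> Hom C y z\<rbrakk>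
          \<Longrightarrow> Cmp C g f \<in> Hom C x z"
    and Cmp_Idt_right: "\<lbrakk>x \<in> Ob C; y \<in> Ob C; f \<in> Hom C x y\<rbrakk> \<Longrightarrow> Cmp C f (Idt C x) = f"
    and Cmp_Idt_left: "\<lbrakk>x \<in> Ob C; y \<in> Ob C; f \<in> Hom C x y\<rbrakk> \<Longrightarrow> Cmp C (Idt C y) f = f"
    and Cmp_assoc: "\<lbrakk>w \<in> Ob C; x \<in> Ob C; y \<in> Ob C; z \<in> Ob C;
            f \<in> Hom C w x; g \<in> Hom C x y; h \<in> Hom C y z\<rbrakk>
          \<Longrightarrow> Cmp C (Cmp C h g) f = Cmp C h (Cmp C g f)"

locale cat_functor = C: category C + D: category D
  for C :: "('o, 'm) hom_cat" and D :: "('p, 'n) hom_cat" +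
  fixes Fo :: "'o \<Rightarrow> 'p" and Fa :: "'o \<Rightarrow> 'o \<Rightarrow> 'm \<Rightarrow> 'n"
  assumes Fo_in_Ob: "x \<in> Ob C \<Longrightarrow> Fo x \<in> Ob D"
    and Fa_in_Hom: "\<lbrakk>x \<in> Ob C; y \<in> Ob C; f \<in> Hom C x y\<rbrakk> \<Longrightarrow> Fa x y f \<in> Hom D (Fo x) (Fo y)"
    and Fa_Idt: "x \<in> Ob C \<Longrightarrow> Fa x x (Idt C x) = Idt D (Fo x)"
    and Fa_Cmp: "\<lbrakk>x \<in> Ob C; y \<in> Ob C; z \<in> Ob C; f \<in> Hom C x y; g \<in> Hom C y z\<rbrakk>
          \<Longrightarrow> Fa x z (Cmp C g f) = Cmp D (Fa y z g) (Fa x y f)"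

definition cat_iso :: "('o, 'm) hom_cat \<Rightarrow> 'o \<Rightarrow> 'o \<Rightarrow> 'm \<Rightarrow> bool" where
  "cat_iso C x y f \<longleftrightarrow> f \<in> Hom C x y \<and>
     (\<exists>g\<in>Hom C y x. Cmp C g f = Idt C x \<and> Cmp C f g = Idt C y)"

locale natural_iso = F: cat_functor C D Fo Fa + G: cat_functor C D Go Ga
  for C :: "('o, 'm) hom_cat" and D :: "('p, 'n) hom_cat" and Fo Fa Go Ga +
  fixes \<eta> :: "'o \<Rightarrow> 'n"
  assumes component_iso: "x \<in> Ob C \<Longrightarrow> cat_iso D (Fo x) (Go x) (\<eta> x)"
    and naturality: "\<lbrakk>x \<in> Ob C; y \<in> Ob C; f \<in> Hom C x y\<rbrakk>
          \<Longrightarrow> Cmp D (\<eta> y) (Fa x y f) = Cmp D (Ga x y f) (\<eta> x)"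

definition cat_equivalence ::
  "('o, 'm) hom_cat \<Rightarrow> ('p, 'n) hom_cat \<Rightarrow> ('o \<Rightarrow> 'p) \<Rightarrow> ('o \<Rightarrow> 'o \<Rightarrow> 'm \<Rightarrow> 'n) \<Rightarrow> bool" where
  "cat_equivalence C D Fo Fa \<longleftrightarrow> cat_functor C D Fo Fa \<and>
     (\<exists>Go Ga \<eta> \<epsilon>. cat_functor D C Go Ga \<and>
        natural_iso C C (\<lambda>x. x) (\<lambda>x y f. f)
          (\<lambda>x. Go (Fo x)) (\<lambda>x y f. Ga (Fo x) (Fo y) (Fa x y f)) \<eta> \<and>
        natural_iso D D (\<lambda>x. Fo (Go x)) (\<lambda>x y f. Fa (Go x) (Go y) (Ga x y f))
          (\<lambda>x. x) (\<lambda>x y f. f) \<epsilon>)"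

definition action_groupoid ::
  "('g, 'b) monoid_scheme \<Rightarrow> 'x set \<Rightarrow> ('g \<Rightarrow> 'x \<Rightarrow> 'x) \<Rightarrow> ('x, 'g) hom_cat" where
  "action_groupoid G X act =
     \<lparr>Ob = X, Hom = (\<lambda>x y. {g \<in> carrier G. act g x = y}), Idt = (\<lambda>x. \<one>\<^bsub>G\<^esub>), Cmp = mult G\<rparr>"


section \<open>Hurwitz algebras\<close>

text \<open>The carrier of the algebra is the whole type \<open>'a\<close>; \<open>amul\<close> is the multiplication,
  \<open>aone\<close> the identity element and \<open>nrm\<close> the norm.\<close>

record ('k, 'a) normed_alg =
  smul :: "'k \<Rightarrow> 'a \<Rightarrow> 'a"
  amul :: "'a \<Rightarrow> 'a \<Rightarrow> 'a"
  aone :: 'a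
  nrm :: "'a \<Rightarrow> 'k"

definition polar :: "('k::field, 'a::ab_group_add) normed_alg \<Rightarrow> 'a \<Rightarrow> 'a \<Rightarrow> 'k" where
  "polar A x y = nrm A (x + y) - nrm A x - nrm A y"

locale hurwitz_algebra = vector_space "smul A"
  for A :: "('k::field, 'a::ab_group_add) normed_alg" +
  assumes finite_dim: "\<exists>B. finite B \<and> span B = UNIV"
    and nonzero: "\<exists>x::'a. x \<noteq> 0"
    and amul_linear_left: "Vector_Spaces.linear (smul A) (smul A) (\<lambda>x. amul A x y)"
    and amul_linear_right: "Vector_Spaces.linear (smul A) (smul A) (\<lambda>y. amul A x y)"
    and aone_left: "amul A (aone A) x = x"
    and aone_right: "amul A x (aone A) = x"
    and nrm_smul: "nrm A (smul A c x) = c\<^sup>2 * nrm A x"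
    and polar_linear_left: "Vector_Spaces.linear (smul A) (*) (\<lambda>x. polar A x y)"
    and polar_linear_right: "Vector_Spaces.linear (smul A) (*) (\<lambda>y. polar A x y)"
    and polar_nondegenerate: "(\<And>y. polar A x y = 0) \<Longrightarrow> x = 0"
    and nrm_amul: "nrm A (amul A x y) = nrm A x * nrm A y"

definition Lmul :: "('k::field, 'a::ab_group_add) normed_alg \<Rightarrow> 'a \<Rightarrow> 'a \<Rightarrow> 'a" where
  "Lmul A a = (\<lambda>x. amul A a x)"

definition Rmul :: "('k::field, 'a::ab_group_add) normed_alg \<Rightarrow> 'a \<Rightarrow> 'a \<Rightarrow> 'a" where
  "Rmul A a = (\<lambda>x. amul A x a)"


section \<open>Linear groups, similitudes and triality\<close>

definition GL :: "('k::field, 'a::ab_group_add) normed_alg \<Rightarrow> ('a \<Rightarrow> 'a) monoid" where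
  "GL A = \<lparr>carrier = {f. Vector_Spaces.linear (smul A) (smul A) f \<and> bij f},
           mult = (\<circ>), one = id\<rparr>"

definition scalar_maps :: "('k::field, 'a::ab_group_add) normed_alg \<Rightarrow> ('a \<Rightarrow> 'a) set" where
  "scalar_maps A = {smul A c | c. c \<noteq> 0}"

definition PGL :: "('k::field, 'a::ab_group_add) normed_alg \<Rightarrow> ('a \<Rightarrow> 'a) set monoid" where
  "PGL A = GL A Mod scalar_maps A"

definition pgl_class :: "('k::field, 'a::ab_group_add) normed_alg \<Rightarrow> ('a \<Rightarrow> 'a) \<Rightarrow> ('a \<Rightarrow> 'a) set" where
  "pgl_class A \<alpha> = scalar_maps A #>\<^bsub>GL A\<^esub> \<alpha>"

definition GO :: "('k::field, 'a::ab_group_add) normed_alg \<Rightarrow> ('a \<Rightarrow> 'a) monoid" where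
  "GO A = (GL A)\<lparr>carrier :=
     {\<phi> \<in> carrier (GL A). \<exists>\<mu>. \<mu> \<noteq> 0 \<and> (\<forall>x. nrm A (\<phi> x) = \<mu> * nrm A x)}\<rparr>"

definition triality_components ::
  "('k::field, 'a::ab_group_add) normed_alg \<Rightarrow> ('a \<Rightarrow> 'a) \<Rightarrow> ('a \<Rightarrow> 'a) \<Rightarrow> ('a \<Rightarrow> 'a) \<Rightarrow> bool" where
  "triality_components A \<phi> \<phi>1 \<phi>2 \<longleftrightarrow> \<phi>1 \<in> carrier (GO A) \<and> \<phi>2 \<in> carrier (GO A) \<and>
     (\<forall>x y. \<phi> (amul A x y) = amul A (\<phi>1 x) (\<phi>2 y))"

definition G_grp :: "('k::field, 'a::ab_group_add) normed_alg \<Rightarrow> ('a \<Rightarrow> 'a) monoid" where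
  "G_grp A = (GL A)\<lparr>carrier :=
     {\<phi> \<in> carrier (GO A). \<exists>\<phi>1 \<phi>2. triality_components A \<phi> \<phi>1 \<phi>2}\<rparr>"

definition PG :: "('k::field, 'a::ab_group_add) normed_alg \<Rightarrow> ('a \<Rightarrow> 'a) set monoid" where
  "PG A = G_grp A Mod scalar_maps A"

definition pg_class :: "('k::field, 'a::ab_group_add) normed_alg \<Rightarrow> ('a \<Rightarrow> 'a) \<Rightarrow> ('a \<Rightarrow> 'a) set" where
  "pg_class A \<phi> = scalar_maps A #>\<^bsub>G_grp A\<^esub> \<phi>"


section \<open>Principal isotopes\<close>

text \<open>All isotopes share the underlying vector space of \<open>A\<close>, so the algebra
  $A_{\alpha,\beta}$ is encoded by its multiplication. In particular, different pairs
  $(\alpha,\beta)$ may give the same object.\<close>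

definition isotope ::
  "('k::field, 'a::ab_group_add) normed_alg \<Rightarrow> ('a \<Rightarrow> 'a) \<Rightarrow> ('a \<Rightarrow> 'a) \<Rightarrow> 'a \<Rightarrow> 'a \<Rightarrow> 'a" where
  "isotope A \<alpha> \<beta> = (\<lambda>x y. amul A (\<alpha> x) (\<beta> y))"

definition isotope_groupoid ::
  "('k::field, 'a::ab_group_add) normed_alg \<Rightarrow> ('a \<Rightarrow> 'a \<Rightarrow> 'a, 'a \<Rightarrow> 'a) hom_cat" where
  "isotope_groupoid A =
     \<lparr>Ob = {isotope A \<alpha> \<beta> | \<alpha> \<beta>. \<alpha> \<in> carrier (GL A) \<and> \<beta> \<in> carrier (GL A)},
      Hom = (\<lambda>m m'. {\<phi> \<in> carrier (GL A). \<forall>x y. \<phi> (m x y) = m' (\<phi> x) (\<phi> y)}),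
      Idt = (\<lambda>m. id),
      Cmp = (\<circ>)\<rparr>"


section \<open>The set of orbits and the action on it\<close>

definition nucleus :: "('k::field, 'a::ab_group_add) normed_alg \<Rightarrow> 'a set" where
  "nucleus A = {a. \<forall>x y z. a \<in> {x, y, z} \<longrightarrow> amul A (amul A x y) z = amul A x (amul A y z)}"

definition nucleus_units :: "('k::field, 'a::ab_group_add) normed_alg \<Rightarrow> 'a monoid" where
  "nucleus_units A = units_of \<lparr>carrier = nucleus A, mult = amul A, one = aone A\<rparr>"

text \<open>Since $[R_w^{-1}\alpha] = [R_w^{-1}][\alpha]$ and $[L_w\beta] = [L_w][\beta]$, the action of the
  nucleus on pairs of classes is written with the product of \<open>PGL A\<close>; no representatives
  are needed.\<close>

definition nucleus_act :: "('k::field, 'a::ab_group_add) normed_alg \<Rightarrow> 'a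
    \<Rightarrow> ('a \<Rightarrow> 'a) set \<times> ('a \<Rightarrow> 'a) set \<Rightarrow> ('a \<Rightarrow> 'a) set \<times> ('a \<Rightarrow> 'a) set" where
  "nucleus_act A w = (\<lambda>(P, Q).
     (pgl_class A (inv\<^bsub>GL A\<^esub> (Rmul A w)) \<otimes>\<^bsub>PGL A\<^esub> P, pgl_class A (Lmul A w) \<otimes>\<^bsub>PGL A\<^esub> Q))"

definition X_set :: "('k::field, 'a::ab_group_add) normed_alg
    \<Rightarrow> (('a \<Rightarrow> 'a) set \<times> ('a \<Rightarrow> 'a) set) set set" where
  "X_set A = orbits (nucleus_units A) (carrier (PGL A) \<times> carrier (PGL A)) (nucleus_act A)"

definition X_class :: "('k::field, 'a::ab_group_add) normed_alg \<Rightarrow> ('a \<Rightarrow> 'a) \<Rightarrow> ('a \<Rightarrow> 'a)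
    \<Rightarrow> (('a \<Rightarrow> 'a) set \<times> ('a \<Rightarrow> 'a) set) set" where
  "X_class A \<alpha> \<beta> = orbit (nucleus_units A) (nucleus_act A) (pgl_class A \<alpha>, pgl_class A \<beta>)"

text \<open>The action of \<open>PG A\<close> on \<open>X_set A\<close> is defined by means of arbitrary representatives
  and triality components; \<open>THE\<close> expresses that the result does not depend on them.\<close>

definition pg_act :: "('k::field, 'a::ab_group_add) normed_alg \<Rightarrow> ('a \<Rightarrow> 'a) set
    \<Rightarrow> (('a \<Rightarrow> 'a) set \<times> ('a \<Rightarrow> 'a) set) set \<Rightarrow> (('a \<Rightarrow> 'a) set \<times> ('a \<Rightarrow> 'a) set) set" where
  "pg_act A P Y = (THE Z. \<exists>\<phi> \<phi>1 \<phi>2 \<alpha> \<beta>.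
     \<phi> \<in> carrier (G_grp A) \<and> P = pg_class A \<phi> \<and> triality_components A \<phi> \<phi>1 \<phi>2 \<and>
     \<alpha> \<in> carrier (GL A) \<and> \<beta> \<in> carrier (GL A) \<and> Y = X_class A \<alpha> \<beta> \<and>
     Z = X_class A (\<phi>1 \<circ> \<alpha> \<circ> inv\<^bsub>GL A\<^esub> \<phi>) (\<phi>2 \<circ> \<beta> \<circ> inv\<^bsub>GL A\<^esub> \<phi>))"

definition X_groupoid :: "('k::field, 'a::ab_group_add) normed_alg
    \<Rightarrow> ((('a \<Rightarrow> 'a) set \<times> ('a \<Rightarrow> 'a) set) set, ('a \<Rightarrow> 'a) set) hom_cat" where
  "X_groupoid A = action_groupoid (PG A) (X_set A) (pg_act A)"

end

theory Submission
  imports Defs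
begin

text \<open>
  The proof rests on a description of \<open>X_A\<close> that mentions neither the nucleus nor pairs of maps:
  two pairs \<open>(\<alpha>, \<beta>)\<close> and \<open>(\<gamma>, \<delta>)\<close> define the same point of \<open>X_A\<close> if and only if the
  multiplications of \<open>A\<^bsub>\<alpha>,\<beta>\<^esub>\<close> and \<open>A\<^bsub>\<gamma>,\<delta>\<^esub>\<close> differ by a non-zero scalar factor
  (\<open>X_class_eq_isotope_class\<close>, \<open>isotope_class_eq_iff\<close>). So \<open>X_A\<close> is the set of isotope
  multiplications modulo \<open>k\<^sup>*\<close>. The reason is that if \<open>\<sigma>(x)\<tau>(y) = xy\<close> for all \<open>x, y\<close> then, with
  \<open>w = \<tau>(1)\<close>, one finds \<open>\<sigma> = R_w\<^sup>-\<^sup>1\<close>, \<open>\<tau> = L_w\<close> and \<open>(xw)y = x(wy)\<close>, so that \<open>w\<close> is an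
  invertible element of the middle nucleus; as a Hurwitz algebra is alternative, its middle nucleus
  is the whole nucleus.

  In this description \<open>[\<phi>] \<in> PG(A)\<close> acts on \<open>X_A\<close> by transport of structure, sending a
  multiplication \<open>m\<close> to \<open>\<phi>(m(\<phi>\<^sup>-\<^sup>1 x, \<phi>\<^sup>-\<^sup>1 y))\<close>: the formula \<open>[\<phi>\<^sub>1\<alpha>\<phi>\<^sup>-\<^sup>1, \<phi>\<^sub>2\<beta>\<phi>\<^sup>-\<^sup>1]\<close> says just
  this (\<open>pg_act_isotope_class\<close>), and it is evident that the choices of representatives and of
  triality components do not matter. An isomorphism \<open>m \<rightarrow> m'\<close> is a bijection
  transporting \<open>m\<close> to \<open>m'\<close>, and it acts on classes accordingly. That it lies in \<open>G(A)\<close> at all is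
  the second ingredient (\<open>autotopy_similitudes\<close>): every autotopy of \<open>A\<close> consists of similitudes,
  because the norm of a Hurwitz algebra is determined by its multiplication through the quadratic
  equation \<open>x\<^sup>2 - \<langle>x,1\<rangle>x + n(x)1 = 0\<close>.

  The functor is full and faithful by a rescaling: if \<open>\<phi>\<close> transports \<open>m\<close> to \<open>c m'\<close>, then
  \<open>d\<phi>\<close> transports \<open>m\<close> to \<open>d\<^sup>-\<^sup>1c m'\<close>, so exactly one representative of the class \<open>[\<phi>]\<close>, namely
  \<open>c\<phi>\<close>, is an isomorphism \<open>m \<rightarrow> m'\<close>. Being surjective on objects as well, the functor is an
  equivalence.
\<close>


section \<open>Fully faithful functors that are surjective on objects\<close>

text \<open>An inverse functor picks a preimage of every object and lifts morphisms along the bijections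
  of hom-sets; the unit and the counit are lifts of identities.\<close>

lemma (in cat_functor) cat_equivalence_if_fully_faithful_surjective:
  assumes bij: "\<And>x y. x \<in> Ob C \<Longrightarrow> y \<in> Ob C \<Longrightarrow> bij_betw (Fa x y) (Hom C x y) (Hom D (Fo x) (Fo y))"
    and surj: "\<And>y. y \<in> Ob D \<Longrightarrow> \<exists>x\<in>Ob C. Fo x = y"
  shows "cat_equivalence C D Fo Fa"
proof -
  define Go where "Go y = (SOME x. x \<in> Ob C \<and> Fo x = y)" for y
  define lift where "lift x y = inv_into (Hom C x y) (Fa x y)" for x y
  have "Go y \<in> Ob C \<and> Fo (Go y) = y" if "y \<in> Ob D" for y
    unfolding Go_def by (rule someI_ex) (use surj[OF that] in blast)
  then have Go: "Go y \<in> Ob C" "Fo (Go y) = y" if "y \<in> Ob D" for y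
    using that by auto
  have lift_Hom: "lift x y g \<in> Hom C x y" and Fa_lift: "Fa x y (lift x y g) = g"
    if "x \<in> Ob C" "y \<in> Ob C" "g \<in> Hom D (Fo x) (Fo y)" for x y g
    using bij[OF that(1,2)] that(3) unfolding lift_def
    by (auto simp: bij_betw_def inv_into_into f_inv_into_f)
  have faithful: "f = g" if "x \<in> Ob C" "y \<in> Ob C" "f \<in> Hom C x y" "g \<in> Hom C x y"
      "Fa x y f = Fa x y g" for x y f g
    using bij[OF that(1,2)] that(3-5) unfolding bij_betw_def by (blast dest: inj_onD)
  define Ga where "Ga y z = lift (Go y) (Go z)" for y z
  have Ga_Hom: "Ga y z g \<in> Hom C (Go y) (Go z)" and Fa_Ga: "Fa (Go y) (Go z) (Ga y z g) = g"
    if "y \<in> Ob D" "z \<in> Ob D" "g \<in> Hom D y z" for y z g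
    using that Go lift_Hom[of "Go y" "Go z" g] Fa_lift[of "Go y" "Go z" g] by (auto simp: Ga_def)
  have G: "cat_functor D C Go Ga"
  proof
    fix x assume x: "x \<in> Ob D"
    show "Go x \<in> Ob C" by (rule Go(1)[OF x])
    show "Ga x x (Idt D x) = Idt C (Go x)"
      by (rule faithful[of "Go x" "Go x"])
        (use x Go[OF x] in \<open>simp_all add: Ga_Hom Fa_Ga Fa_Idt C.Idt_in_Hom D.Idt_in_Hom\<close>)
  next
    fix x y z f g
    assume o: "x \<in> Ob D" "y \<in> Ob D" "z \<in> Ob D" and f: "f \<in> Hom D x y" and g: "g \<in> Hom D y z"
    note comp = C.Cmp_in_Hom[OF Go(1)[OF o(1)] Go(1)[OF o(2)] Go(1)[OF o(3)]
        Ga_Hom[OF o(1,2) f] Ga_Hom[OF o(2,3) g]]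
    show "Ga x z (Cmp D g f) = Cmp C (Ga y z g) (Ga x y f)"
      by (rule faithful[OF Go(1)[OF o(1)] Go(1)[OF o(3)] Ga_Hom comp])
        (use o f g in \<open>simp_all add: Fa_Ga Ga_Hom Go D.Cmp_in_Hom[of x y z]
          Fa_Cmp[of "Go x" "Go y" "Go z"]\<close>)
  qed (use Ga_Hom in auto)
  interpret G: cat_functor D C Go Ga by (rule G)
  define \<eta> where "\<eta> x = lift x (Go (Fo x)) (Idt D (Fo x))" for x
  define \<eta>' where "\<eta>' x = lift (Go (Fo x)) x (Idt D (Fo x))" for x
  have FG: "Go (Fo x) \<in> Ob C" "Fo (Go (Fo x)) = Fo x" if "x \<in> Ob C" for x
    using that Go Fo_in_Ob by auto
  have \<eta>: "\<eta> x \<in> Hom C x (Go (Fo x))" "Fa x (Go (Fo x)) (\<eta> x) = Idt D (Fo x)"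
    and \<eta>': "\<eta>' x \<in> Hom C (Go (Fo x)) x" "Fa (Go (Fo x)) x (\<eta>' x) = Idt D (Fo x)"
    if "x \<in> Ob C" for x
    using that FG[OF that] Fo_in_Ob[OF that] D.Idt_in_Hom[of "Fo x"] unfolding \<eta>_def \<eta>'_def
    by (auto intro!: lift_Hom Fa_lift)
  have unit: "natural_iso C C (\<lambda>x. x) (\<lambda>x y f. f)
          (\<lambda>x. Go (Fo x)) (\<lambda>x y f. Ga (Fo x) (Fo y) (Fa x y f)) \<eta>"
  proof unfold_locales
    fix x assume x: "x \<in> Ob C"
    have "Cmp C (\<eta>' x) (\<eta> x) = Idt C x"
      by (rule faithful[of x x])
        (use x FG[OF x] in \<open>simp_all add: C.Cmp_in_Hom[of x "Go (Fo x)" x] C.Idt_in_Hom \<eta> \<eta>' Fa_Idt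
          Fa_Cmp[of x "Go (Fo x)" x] D.Cmp_Idt_right[OF Fo_in_Ob Fo_in_Ob D.Idt_in_Hom] Fo_in_Ob\<close>)
    moreover have "Cmp C (\<eta> x) (\<eta>' x) = Idt C (Go (Fo x))"
      by (rule faithful[of "Go (Fo x)" "Go (Fo x)"])
        (use x FG[OF x] in \<open>simp_all add: C.Cmp_in_Hom[of "Go (Fo x)" x "Go (Fo x)"] C.Idt_in_Hom
          \<eta> \<eta>' Fa_Idt Fa_Cmp[of "Go (Fo x)" x "Go (Fo x)"]
          D.Cmp_Idt_right[OF Fo_in_Ob Fo_in_Ob D.Idt_in_Hom] Fo_in_Ob\<close>)
    ultimately show "cat_iso C x (Go (Fo x)) (\<eta> x)"
      unfolding cat_iso_def using \<eta>(1)[OF x] \<eta>'(1)[OF x] by blast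
  next
    fix x y f assume x: "x \<in> Ob C" and y: "y \<in> Ob C" and f: "f \<in> Hom C x y"
    have Ff: "Fa x y f \<in> Hom D (Fo x) (Fo y)" by (rule Fa_in_Hom[OF x y f])
    note Gf = Ga_Hom[OF Fo_in_Ob[OF x] Fo_in_Ob[OF y] Ff]
      and FGf = Fa_Ga[OF Fo_in_Ob[OF x] Fo_in_Ob[OF y] Ff]
    show "Cmp C (\<eta> y) f = Cmp C (Ga (Fo x) (Fo y) (Fa x y f)) (\<eta> x)"
    proof (rule faithful[OF x FG(1)[OF y]])
      show "Cmp C (\<eta> y) f \<in> Hom C x (Go (Fo y))"
        by (rule C.Cmp_in_Hom[OF x y FG(1)[OF y] f \<eta>(1)[OF y]])
      show "Cmp C (Ga (Fo x) (Fo y) (Fa x y f)) (\<eta> x) \<in> Hom C x (Go (Fo y))"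
        by (rule C.Cmp_in_Hom[OF x FG(1)[OF x] FG(1)[OF y] \<eta>(1)[OF x] Gf])
      show "Fa x (Go (Fo y)) (Cmp C (\<eta> y) f)
          = Fa x (Go (Fo y)) (Cmp C (Ga (Fo x) (Fo y) (Fa x y f)) (\<eta> x))"
        by (simp add: Fa_Cmp[OF x y FG(1)[OF y] f \<eta>(1)[OF y]]
            Fa_Cmp[OF x FG(1)[OF x] FG(1)[OF y] \<eta>(1)[OF x] Gf] FGf \<eta>(2) x y
            D.Cmp_Idt_left[OF Fo_in_Ob[OF x] Fo_in_Ob[OF y] Ff]
            D.Cmp_Idt_right[OF Fo_in_Ob[OF x] Fo_in_Ob[OF y] Ff])
    qed
  qed (auto simp: Fo_in_Ob FG Ga_Hom Fa_in_Hom Fa_Idt G.Fa_Idt Fa_Cmp G.Fa_Cmp intro: G.Fo_in_Ob)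
  have counit: "natural_iso D D (\<lambda>x. Fo (Go x)) (\<lambda>x y f. Fa (Go x) (Go y) (Ga x y f))
          (\<lambda>x. x) (\<lambda>x y f. f) (Idt D)"
  proof unfold_locales
    fix x assume x: "x \<in> Ob D"
    then show "cat_iso D (Fo (Go x)) x (Idt D x)"
      by (auto simp: cat_iso_def Go D.Idt_in_Hom D.Cmp_Idt_left[OF x x D.Idt_in_Hom[OF x]]
          intro!: bexI[of _ "Idt D x"])
  qed (auto simp: Go Ga_Hom Fa_Ga D.Idt_in_Hom D.Cmp_Idt_left D.Cmp_Idt_right D.Cmp_in_Hom)
  show ?thesis
    unfolding cat_equivalence_def using cat_functor_axioms G unit counit by blast
qed


section \<open>Composition, alternativity and the nucleus\<close>

context hurwitz_algebra
begin

abbreviation prod_A :: "'a \<Rightarrow> 'a \<Rightarrow> 'a" (infixl "\<cdot>" 70) where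
  "x \<cdot> y \<equiv> amul A x y"

abbreviation one_A :: 'a ("\<e>") where
  "\<e> \<equiv> aone A"

lemma mul_add_left: "(x + y) \<cdot> z = x \<cdot> z + y \<cdot> z"
  and mul_smul_left: "smul A c x \<cdot> z = smul A c (x \<cdot> z)"
  and mul_add_right: "z \<cdot> (x + y) = z \<cdot> x + z \<cdot> y"
  and mul_smul_right: "z \<cdot> smul A c x = smul A c (z \<cdot> x)"
  using amul_linear_left[of z] amul_linear_right[of z] unfolding Vector_Spaces.linear_iff by auto

lemma polar_add_left: "polar A (x + y) z = polar A x z + polar A y z"
  and polar_smul_left: "polar A (smul A c x) z = c * polar A x z"
  and polar_add_right: "polar A z (x + y) = polar A z x + polar A z y"
  using polar_linear_left[of z] polar_linear_right[of z] unfolding Vector_Spaces.linear_iff by auto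

lemma polar_diff_left: "polar A (x - y) z = polar A x z - polar A y z"
  by (metis add_diff_cancel diff_add_cancel polar_add_left)

lemma polar_commute: "polar A x y = polar A y x"
  by (simp add: polar_def add.commute)

lemma polar_eqI:
  assumes "\<And>z. polar A x z = polar A y z"
  shows "x = y"
  using polar_nondegenerate[of "x - y"] assms by (simp add: polar_diff_left)

lemma nrm_add: "nrm A (x + y) = nrm A x + nrm A y + polar A x y"
  by (simp add: polar_def)

lemma polar_mul_left: "polar A (x \<cdot> y) (x \<cdot> z) = nrm A x * polar A y z"
  by (simp add: polar_def mul_add_right[symmetric] nrm_amul algebra_simps)

lemma polar_mul_right: "polar A (y \<cdot> x) (z \<cdot> x) = nrm A x * polar A y z"
  by (simp add: polar_def mul_add_left[symmetric] nrm_amul algebra_simps)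

lemma polar_mul_exchange:
  "polar A (x \<cdot> y) (w \<cdot> z) + polar A (w \<cdot> y) (x \<cdot> z) = polar A x w * polar A y z"
  using polar_mul_left[of "x + w" y z]
  by (simp add: mul_add_left polar_add_left polar_add_right polar_mul_left nrm_add polar_commute[of w x]
      algebra_simps)

lemma polar_mul_adjoint_left:
  "polar A (x \<cdot> y) z + polar A y (x \<cdot> z) = polar A x \<e> * polar A y z"
  using polar_mul_exchange[of x y \<e> z] by (simp add: aone_left)

lemma polar_mul_adjoint_right:
  "polar A (y \<cdot> x) z + polar A y (z \<cdot> x) = polar A x \<e> * polar A y z"
  using polar_mul_exchange[of y x z \<e>] by (simp add: aone_right mult.commute polar_commute)

lemma quadratic_equation: "x \<cdot> x + smul A (nrm A x) \<e> = smul A (polar A x \<e>) x"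
proof (rule polar_eqI)
  fix z
  show "polar A (x \<cdot> x + smul A (nrm A x) \<e>) z = polar A (smul A (polar A x \<e>) x) z"
    using polar_mul_adjoint_left[of x x z] polar_mul_left[of x \<e> z]
    by (simp add: polar_add_left polar_smul_left aone_right)
qed

text \<open>Multiplication by the conjugate \<open>\<langle>x,1\<rangle>1 - x\<close> is adjoint to multiplication by \<open>x\<close> with respect
  to the polar form, and multiplication by \<open>x\<close> multiplies that form by \<open>n(x)\<close>. So multiplying by
  \<open>x\<close> and then, on the same side, by its conjugate is multiplication by the scalar \<open>n(x)\<close>; this is
  the identity below, and its mirror image after it. Combined with the quadratic equation they
  become the alternative laws.\<close>

lemma mul_mul_left: "x \<cdot> (x \<cdot> y) + smul A (nrm A x) y = smul A (polar A x \<e>) (x \<cdot> y)"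
proof (rule polar_eqI)
  fix z
  show "polar A (x \<cdot> (x \<cdot> y) + smul A (nrm A x) y) z = polar A (smul A (polar A x \<e>) (x \<cdot> y)) z"
    using polar_mul_adjoint_left[of x "x \<cdot> y" z]
    by (simp add: polar_add_left polar_smul_left polar_mul_left)
qed

lemma mul_mul_right: "(y \<cdot> x) \<cdot> x + smul A (nrm A x) y = smul A (polar A x \<e>) (y \<cdot> x)"
proof (rule polar_eqI)
  fix z
  show "polar A ((y \<cdot> x) \<cdot> x + smul A (nrm A x) y) z = polar A (smul A (polar A x \<e>) (y \<cdot> x)) z"
    using polar_mul_adjoint_right[of "y \<cdot> x" x z]
    by (simp add: polar_add_left polar_smul_left polar_mul_right)
qed

lemma left_alternative: "x \<cdot> (x \<cdot> y) = (x \<cdot> x) \<cdot> y"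
proof -
  have "(x \<cdot> x) \<cdot> y + smul A (nrm A x) y = (x \<cdot> x + smul A (nrm A x) \<e>) \<cdot> y"
    by (simp add: mul_add_left mul_smul_left aone_left)
  also have "\<dots> = x \<cdot> (x \<cdot> y) + smul A (nrm A x) y"
    by (simp add: quadratic_equation mul_mul_left mul_smul_left)
  finally show ?thesis by simp
qed

lemma right_alternative: "(y \<cdot> x) \<cdot> x = y \<cdot> (x \<cdot> x)"
proof -
  have "y \<cdot> (x \<cdot> x) + smul A (nrm A x) y = y \<cdot> (x \<cdot> x + smul A (nrm A x) \<e>)"
    by (simp add: mul_add_right mul_smul_right aone_right)
  also have "\<dots> = (y \<cdot> x) \<cdot> x + smul A (nrm A x) y"
    by (simp add: quadratic_equation mul_mul_right mul_smul_right)
  finally show ?thesis by simp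
qed

text \<open>Linearizing the alternative laws shows that the associator changes sign when two adjacent
  arguments are exchanged, so an element that associates in the middle position does so in all.\<close>

lemma nucleus_if_middle:
  assumes "\<And>x y. (x \<cdot> w) \<cdot> y = x \<cdot> (w \<cdot> y)"
  shows "w \<in> nucleus A"
proof -
  have "(w \<cdot> x) \<cdot> y = w \<cdot> (x \<cdot> y)" for x y
    using left_alternative[of "w + x" y] left_alternative[of w y] left_alternative[of x y] assms[of x y]
    by (simp add: mul_add_left mul_add_right algebra_simps)
  moreover have "(x \<cdot> y) \<cdot> w = x \<cdot> (y \<cdot> w)" for x y
    using right_alternative[of x "w + y"] right_alternative[of x w] right_alternative[of x y] assms[of x y]
    by (simp add: mul_add_left mul_add_right algebra_simps)
  ultimately show ?thesis
    using assms by (auto simp: nucleus_def)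
qed

lemma nucleusD:
  assumes "w \<in> nucleus A"
  shows "(w \<cdot> x) \<cdot> y = w \<cdot> (x \<cdot> y)" "(x \<cdot> w) \<cdot> y = x \<cdot> (w \<cdot> y)" "(x \<cdot> y) \<cdot> w = x \<cdot> (y \<cdot> w)"
  using assms unfolding nucleus_def by blast+

lemma nucleus_units_iff:
  "w \<in> carrier (nucleus_units A) \<longleftrightarrow> w \<in> nucleus A \<and> (\<exists>v. v \<cdot> w = \<e> \<and> w \<cdot> v = \<e>)"
proof
  assume *: "w \<in> nucleus A \<and> (\<exists>v. v \<cdot> w = \<e> \<and> w \<cdot> v = \<e>)"
  then obtain v where w: "w \<in> nucleus A" and vw: "v \<cdot> w = \<e>" and wv: "w \<cdot> v = \<e>" by blast
  have "(x \<cdot> v) \<cdot> y = x \<cdot> (v \<cdot> y)" for x y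
  proof -
    have "(x \<cdot> v) \<cdot> y = (x \<cdot> v) \<cdot> (w \<cdot> (v \<cdot> y))"
      by (simp add: nucleusD(1)[OF w, symmetric] wv aone_left)
    also have "\<dots> = x \<cdot> (v \<cdot> y)"
      by (simp add: nucleusD(2)[OF w, symmetric]) (simp add: nucleusD(3)[OF w] vw aone_right)
    finally show ?thesis .
  qed
  then have "v \<in> nucleus A" by (rule nucleus_if_middle)
  with w vw wv show "w \<in> carrier (nucleus_units A)"
    by (auto simp: nucleus_units_def units_of_def Units_def)
qed (auto simp: nucleus_units_def units_of_def Units_def)


section \<open>The norm is determined by the multiplication\<close>

lemma nrm_one: "nrm A \<e> = 1"
proof -
  have "nrm A \<e> \<noteq> 0"
  proof
    assume "nrm A \<e> = 0"
    then have "nrm A x = 0" for x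
      using nrm_amul[of \<e> x] by (simp add: aone_left)
    then have "polar A x y = 0" for x y
      by (simp add: polar_def)
    with polar_nondegenerate nonzero show False by blast
  qed
  with nrm_amul[of \<e> \<e>] show ?thesis by (simp add: aone_left)
qed

lemma one_neq_zero: "\<e> \<noteq> 0"
  using nrm_one nrm_smul[of 0 0] by auto

text \<open>Outside the line \<open>k1\<close> the vectors \<open>x\<close> and \<open>1\<close> are independent, so the quadratic equation
  determines its coefficients, in particular \<open>n(x)\<close>; on that line \<open>n(c1) = c\<^sup>2\<close>.\<close>

lemma nrm_unique:
  assumes "hurwitz_algebra (A\<lparr>nrm := m\<rparr>)"
  shows "m = nrm A"
proof
  fix x
  interpret B: hurwitz_algebra "A\<lparr>nrm := m\<rparr>" by (rule assms)
  let ?t = "polar A x \<e>" and ?s = "polar (A\<lparr>nrm := m\<rparr>) x \<e>"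
  show "m x = nrm A x"
  proof (cases "\<exists>c. x = smul A c \<e>")
    case True
    then obtain c where "x = smul A c \<e>" by blast
    then show ?thesis
      using B.nrm_smul[of c \<e>] B.nrm_one by (simp add: nrm_smul nrm_one)
  next
    case False
    have "x \<cdot> x = smul A ?t x - smul A (nrm A x) \<e>"
      using quadratic_equation[of x] by (simp add: eq_diff_eq)
    moreover have "x \<cdot> x = smul A ?s x - smul A (m x) \<e>"
      using B.quadratic_equation[of x] by (simp add: eq_diff_eq)
    ultimately have eq: "smul A (?t - ?s) x = smul A (nrm A x - m x) \<e>"
      by (simp add: scale_left_diff_distrib algebra_simps)
    have "?t - ?s = 0"
    proof (rule ccontr)
      assume "?t - ?s \<noteq> 0"
      then have "x = smul A (inverse (?t - ?s)) (smul A (?t - ?s) x)"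
        by simp
      also have "\<dots> = smul A (inverse (?t - ?s) * (nrm A x - m x)) \<e>"
        unfolding eq by simp
      finally show False using False by blast
    qed
    with eq one_neq_zero show ?thesis by simp
  qed
qed


section \<open>Autotopies consist of similitudes\<close>

lemma GL_iff:
  "f \<in> carrier (GL A) \<longleftrightarrow>
    (\<forall>x y. f (x + y) = f x + f y) \<and> (\<forall>c x. f (smul A c x) = smul A c (f x)) \<and> bij f"
  using vector_space_axioms by (auto simp: GL_def Vector_Spaces.linear_iff)

lemma GL_D:
  assumes "f \<in> carrier (GL A)"
  shows "f (x + y) = f x + f y" "f (smul A c x) = smul A c (f x)" "bij f"
  using assms by (auto simp: GL_iff)

lemma GL_comp: "f \<in> carrier (GL A) \<Longrightarrow> g \<in> carrier (GL A) \<Longrightarrow> f \<circ> g \<in> carrier (GL A)"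
  by (auto simp: GL_iff intro: bij_comp)

lemma GL_id: "id \<in> carrier (GL A)"
  by (auto simp: GL_iff)

lemma GL_smul: "c \<noteq> 0 \<Longrightarrow> smul A c \<in> carrier (GL A)"
  by (auto simp: GL_iff scale_right_distrib intro!: o_bij[of "smul A (inverse c)"])

lemma GL_inv_fun:
  assumes "f \<in> carrier (GL A)"
  shows "inv_into UNIV f \<in> carrier (GL A)"
proof -
  have b: "bij f" by (rule GL_D(3)[OF assms])
  have "inv_into UNIV f (x + y) = inv_into UNIV f x + inv_into UNIV f y" for x y
    by (rule inv_f_eq[OF bij_is_inj[OF b]]) (simp add: GL_D[OF assms] surj_f_inv_f[OF bij_is_surj[OF b]])
  moreover have "inv_into UNIV f (smul A c x) = smul A c (inv_into UNIV f x)" for c x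
    by (rule inv_f_eq[OF bij_is_inj[OF b]]) (simp add: GL_D[OF assms] surj_f_inv_f[OF bij_is_surj[OF b]])
  ultimately show ?thesis
    by (simp add: GL_iff bij_imp_bij_inv[OF b])
qed

lemma GL_inv:
  assumes "f \<in> carrier (GL A)"
  shows "inv\<^bsub>GL A\<^esub> f \<in> carrier (GL A)" "f ((inv\<^bsub>GL A\<^esub> f) x) = x" "(inv\<^bsub>GL A\<^esub> f) (f x) = x"
proof -
  have mon: "monoid (GL A)"
    by unfold_locales (use GL_comp GL_id in \<open>auto simp: GL_def comp_assoc\<close>)
  note b = GL_D(3)[OF assms]
  have "inv\<^bsub>GL A\<^esub> f = inv_into UNIV f"
    by (rule monoid.inv_unique'[OF mon assms GL_inv_fun[OF assms], symmetric])
      (auto simp: GL_def fun_eq_iff surj_f_inv_f[OF bij_is_surj[OF b]] inv_f_f[OF bij_is_inj[OF b]])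
  then show "inv\<^bsub>GL A\<^esub> f \<in> carrier (GL A)" "f ((inv\<^bsub>GL A\<^esub> f) x) = x" "(inv\<^bsub>GL A\<^esub> f) (f x) = x"
    using GL_inv_fun[OF assms] surj_f_inv_f[OF bij_is_surj[OF b]] inv_f_f[OF bij_is_inj[OF b]]
    by auto
qed

text \<open>The form \<open>n(f(x)) / (n(a)n(b))\<close>, where \<open>a = g(1)\<close> and \<open>b = h(1)\<close>, is again a non-degenerate
  multiplicative norm on \<open>A\<close>, hence equal to \<open>n\<close>. In other words, \<open>f\<close> is an isomorphism from \<open>A\<close>
  onto a unital isotope, and that isotope is a Hurwitz algebra for a multiple of \<open>n\<close>.\<close>

lemma autotopy_similitudes:
  assumes f: "f \<in> carrier (GL A)" and g: "g \<in> carrier (GL A)" and h: "h \<in> carrier (GL A)"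
    and mul: "\<And>x y. f (x \<cdot> y) = g x \<cdot> h y"
  shows "f \<in> carrier (GO A)" "g \<in> carrier (GO A)" "h \<in> carrier (GO A)"
proof -
  define a b where "a = g \<e>" and "b = h \<e>"
  have fg: "f x = g x \<cdot> b" and fh: "f x = a \<cdot> h x" for x
    using mul[of x \<e>] mul[of \<e> x] by (simp_all add: a_def b_def aone_left aone_right)
  obtain u where u: "f u = \<e>"
    using GL_D(3)[OF f] by (metis bij_pointE)
  have "nrm A (g u) * nrm A b = 1" "nrm A a * nrm A (h u) = 1"
    using fg[of u] fh[of u] u nrm_one by (metis nrm_amul)+
  \<comment> \<open>since \<open>f\<close> attains the value \<open>1\<close>, the form \<open>m\<close> has a non-zero denominator\<close>
  then have a0: "nrm A a \<noteq> 0" and b0: "nrm A b \<noteq> 0" by auto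
  define m where "m x = nrm A (f x) / (nrm A a * nrm A b)" for x
  let ?B = "A\<lparr>nrm := m\<rparr>"
  have polar_B: "polar ?B x y = polar A (f x) (f y) / (nrm A a * nrm A b)" for x y
    by (simp add: polar_def m_def GL_D(1)[OF f] diff_divide_distrib)
  have vs: "vector_space ((*) :: 'k \<Rightarrow> 'k \<Rightarrow> 'k)"
    by unfold_locales (auto simp: algebra_simps)
  have "hurwitz_algebra ?B"
  proof (unfold hurwitz_algebra_def hurwitz_algebra_axioms_def, intro conjI allI impI)
    fix x y
    have ml: "nrm A (f (x \<cdot> y)) = nrm A (g x) * nrm A (h y)" by (simp add: mul nrm_amul)
    have "nrm A (f x) = nrm A (g x) * nrm A b" "nrm A (f y) = nrm A a * nrm A (h y)"
      using fg[of x] fh[of y] by (simp_all add: nrm_amul)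
    then show "nrm ?B (amul ?B x y) = nrm ?B x * nrm ?B y"
      using a0 b0 ml by (simp add: m_def field_simps)
  next
    fix x assume "\<forall>y. polar ?B x y = 0"
    then have "polar A (f x) (f y) = 0" for y
      using a0 b0 by (simp add: polar_B)
    then have "polar A (f x) z = 0" for z
      using GL_D(3)[OF f] by (metis bij_pointE)
    then have "f x = 0" by (rule polar_nondegenerate)
    moreover have "f 0 = 0" using GL_D(2)[OF f, of 0 0] by simp
    ultimately show "x = 0"
      using GL_D(3)[OF f] by (metis bij_is_inj injD)
  next
    fix y
    show "Vector_Spaces.linear (smul ?B) (*) (\<lambda>x. polar ?B x y)"
      unfolding Vector_Spaces.linear_iff using vs vector_space_axioms
      by (simp add: polar_B GL_D[OF f] polar_add_left polar_smul_left add_divide_distrib)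
    show "Vector_Spaces.linear (smul ?B) (*) (\<lambda>x. polar ?B y x)"
      unfolding Vector_Spaces.linear_iff using vs vector_space_axioms
      by (simp add: polar_B GL_D[OF f] polar_add_left polar_smul_left add_divide_distrib
          polar_commute[of "f y"])
  qed (use vector_space_axioms finite_dim nonzero amul_linear_left amul_linear_right aone_left
      aone_right in \<open>simp_all add: m_def GL_D[OF f] nrm_smul\<close>)
  then have "m = nrm A" by (rule nrm_unique)
  then have "m x = nrm A x" for x by simp
  then have f_sim: "nrm A (f x) = (nrm A a * nrm A b) * nrm A x" for x
    using a0 b0 by (simp add: m_def field_simps)
  have "nrm A (g x) = nrm A a * nrm A x" and "nrm A (h x) = nrm A b * nrm A x" for x
    using f_sim[of x] a0 b0 arg_cong[OF fg[of x], of "nrm A"] arg_cong[OF fh[of x], of "nrm A"]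
    by (simp_all add: nrm_amul)
  moreover have "\<phi> \<in> carrier (GO A)"
    if "\<phi> \<in> carrier (GL A)" "c \<noteq> 0" "\<And>x. nrm A (\<phi> x) = c * nrm A x" for \<phi> c
    using that by (auto simp: GO_def)
  ultimately show "f \<in> carrier (GO A)" "g \<in> carrier (GO A)" "h \<in> carrier (GO A)"
    using f_sim a0 b0 f g h by (metis mult_eq_0_iff)+
qed

lemma triality_componentsI:
  assumes "f \<in> carrier (GL A)" "g \<in> carrier (GL A)" "h \<in> carrier (GL A)"
    and "\<And>x y. f (x \<cdot> y) = g x \<cdot> h y"
  shows "f \<in> carrier (G_grp A)" "triality_components A f g h"
  using autotopy_similitudes[OF assms] assms(4)
  by (auto simp: G_grp_def triality_components_def)

lemma G_grpE:
  assumes "f \<in> carrier (G_grp A)"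
  obtains g h where "f \<in> carrier (GL A)" "g \<in> carrier (GL A)" "h \<in> carrier (GL A)"
    "\<And>x y. f (x \<cdot> y) = g x \<cdot> h y" "triality_components A f g h"
  using assms by (auto simp: G_grp_def GO_def triality_components_def)

lemma G_grp_GL: "f \<in> carrier (G_grp A) \<Longrightarrow> f \<in> carrier (GL A)"
  by (auto simp: G_grp_def GO_def)

lemma G_grp_comp:
  assumes "f \<in> carrier (G_grp A)" "f' \<in> carrier (G_grp A)"
  shows "f \<circ> f' \<in> carrier (G_grp A)"
proof -
  obtain g h where 1: "f \<in> carrier (GL A)" "g \<in> carrier (GL A)" "h \<in> carrier (GL A)"
    "\<And>x y. f (x \<cdot> y) = g x \<cdot> h y"
    using G_grpE[OF assms(1)] by metis
  obtain g' h' where 2: "f' \<in> carrier (GL A)" "g' \<in> carrier (GL A)" "h' \<in> carrier (GL A)"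
    "\<And>x y. f' (x \<cdot> y) = g' x \<cdot> h' y"
    using G_grpE[OF assms(2)] by metis
  show ?thesis
    by (rule triality_componentsI(1)[of _ "g \<circ> g'" "h \<circ> h'"]) (use 1 2 in \<open>auto intro: GL_comp\<close>)
qed

lemma G_grp_id: "id \<in> carrier (G_grp A)"
  by (rule triality_componentsI(1)[of _ id id]) (auto simp: GL_id)


section \<open>Classes modulo scalars\<close>

lemma pgl_class_eq: "pgl_class A f = {smul A c \<circ> f | c. c \<noteq> 0}"
  by (auto simp: pgl_class_def r_coset_def scalar_maps_def GL_def)

lemma pg_class_eq: "pg_class A f = pgl_class A f"
  by (auto simp: pgl_class_def pg_class_def r_coset_def G_grp_def)

lemma pgl_class_eqD:
  assumes "pgl_class A f = pgl_class A g"
  obtains c where "c \<noteq> 0" "f = smul A c \<circ> g"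
proof -
  have "f \<in> pgl_class A f"
    by (auto simp: pgl_class_eq fun_eq_iff intro!: exI[of _ 1])
  with assms that show ?thesis by (auto simp: pgl_class_eq)
qed

lemma pgl_class_smul:
  assumes "c \<noteq> 0"
  shows "pgl_class A (smul A c \<circ> f) = pgl_class A f"
proof (intro Set.set_eqI iffI)
  fix h assume "h \<in> pgl_class A (smul A c \<circ> f)"
  then obtain d where "d \<noteq> 0" "h = smul A d \<circ> (smul A c \<circ> f)" by (auto simp: pgl_class_eq)
  then show "h \<in> pgl_class A f"
    using assms by (auto simp: pgl_class_eq fun_eq_iff intro!: exI[of _ "d * c"])
next
  fix h assume "h \<in> pgl_class A f"
  then obtain d where "d \<noteq> 0" "h = smul A d \<circ> f" by (auto simp: pgl_class_eq)
  then show "h \<in> pgl_class A (smul A c \<circ> f)"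
    using assms by (auto simp: pgl_class_eq fun_eq_iff intro!: exI[of _ "d / c"])
qed

lemma pgl_class_mult:
  assumes "f \<in> carrier (GL A)"
  shows "pgl_class A f <#>\<^bsub>GL A\<^esub> pgl_class A g = pgl_class A (f \<circ> g)"
proof (intro Set.set_eqI iffI)
  fix h assume "h \<in> pgl_class A f <#>\<^bsub>GL A\<^esub> pgl_class A g"
  then obtain c d where "c \<noteq> 0" "d \<noteq> 0" "h = (smul A c \<circ> f) \<circ> (smul A d \<circ> g)"
    by (auto simp: set_mult_def pgl_class_eq GL_def)
  then show "h \<in> pgl_class A (f \<circ> g)"
    by (auto simp: pgl_class_eq fun_eq_iff GL_D[OF assms] intro!: exI[of _ "c * d"])
next
  fix h assume "h \<in> pgl_class A (f \<circ> g)"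
  then obtain c where c: "c \<noteq> 0" "h = smul A c \<circ> (f \<circ> g)" by (auto simp: pgl_class_eq)
  have "smul A c \<circ> f \<in> pgl_class A f" "g \<in> pgl_class A g"
    using c(1) by (auto simp: pgl_class_eq fun_eq_iff intro: exI[of _ 1])
  moreover have "h = (smul A c \<circ> f) \<otimes>\<^bsub>GL A\<^esub> g"
    using c(2) by (simp add: GL_def comp_assoc)
  ultimately show "h \<in> pgl_class A f <#>\<^bsub>GL A\<^esub> pgl_class A g"
    unfolding set_mult_def by blast
qed

lemma PGL_mult: "f \<in> carrier (GL A) \<Longrightarrow> pgl_class A f \<otimes>\<^bsub>PGL A\<^esub> pgl_class A g = pgl_class A (f \<circ> g)"
  by (simp add: PGL_def FactGroup_def pgl_class_mult)

lemma PG_mult: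
  assumes "f \<in> carrier (G_grp A)"
  shows "pg_class A f \<otimes>\<^bsub>PG A\<^esub> pg_class A g = pg_class A (f \<circ> g)"
proof -
  have "X <#>\<^bsub>G_grp A\<^esub> Y = X <#>\<^bsub>GL A\<^esub> Y" for X Y
    by (simp add: set_mult_def G_grp_def)
  with pgl_class_mult[OF G_grp_GL[OF assms]] show ?thesis
    by (simp add: PG_def FactGroup_def pg_class_eq)
qed

lemma carrier_PGL: "carrier (PGL A) = pgl_class A ` carrier (GL A)"
  by (auto simp: PGL_def FactGroup_def RCOSETS_def pgl_class_def)

lemma carrier_PG: "carrier (PG A) = pg_class A ` carrier (G_grp A)"
  by (auto simp: PG_def FactGroup_def RCOSETS_def pg_class_def)

lemma PG_one: "\<one>\<^bsub>PG A\<^esub> = pg_class A id"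
  by (auto simp: PG_def FactGroup_def pg_class_eq pgl_class_eq scalar_maps_def)


section \<open>Orbits as isotope multiplications modulo scalars\<close>

definition proportional :: "('a \<Rightarrow> 'a \<Rightarrow> 'a) \<Rightarrow> ('a \<Rightarrow> 'a \<Rightarrow> 'a) \<Rightarrow> bool" where
  "proportional m m' \<longleftrightarrow> (\<exists>c. c \<noteq> 0 \<and> (\<forall>x y. m' x y = smul A c (m x y)))"

lemma proportional_refl: "proportional m m"
  by (auto simp: proportional_def intro: exI[of _ 1])

lemma proportional_sym: "proportional m m' \<Longrightarrow> proportional m' m"
proof -
  assume "proportional m m'"
  then obtain c where "c \<noteq> 0" "\<And>x y. m' x y = smul A c (m x y)"
    by (auto simp: proportional_def)
  then show "proportional m' m"
    by (auto simp: proportional_def intro!: exI[of _ "inverse c"])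
qed

lemma proportional_trans: "proportional m m' \<Longrightarrow> proportional m' m'' \<Longrightarrow> proportional m m''"
proof -
  assume "proportional m m'" "proportional m' m''"
  then obtain c d where "c \<noteq> 0" "d \<noteq> 0" "\<And>x y. m' x y = smul A c (m x y)"
    "\<And>x y. m'' x y = smul A d (m' x y)"
    by (auto simp: proportional_def)
  then show "proportional m m''"
    by (auto simp: proportional_def intro!: exI[of _ "d * c"])
qed

text \<open>This set of pairs depends only on the multiplication \<open>m\<close>, and it will turn out to be the
  orbit of \<open>([\<alpha>], [\<beta>])\<close> when \<open>m\<close> is the multiplication of \<open>A\<^bsub>\<alpha>,\<beta>\<^esub>\<close>.\<close>

definition isotope_class ::
  "('a \<Rightarrow> 'a \<Rightarrow> 'a) \<Rightarrow> (('a \<Rightarrow> 'a) set \<times> ('a \<Rightarrow> 'a) set) set" where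
  "isotope_class m = {(pgl_class A \<gamma>, pgl_class A \<delta>) | \<gamma> \<delta>.
     \<gamma> \<in> carrier (GL A) \<and> \<delta> \<in> carrier (GL A) \<and> proportional m (isotope A \<gamma> \<delta>)}"

lemma isotope_classI:
  assumes "\<gamma> \<in> carrier (GL A)" "\<delta> \<in> carrier (GL A)" "proportional m (isotope A \<gamma> \<delta>)"
  shows "(pgl_class A \<gamma>, pgl_class A \<delta>) \<in> isotope_class m"
  unfolding isotope_class_def by (intro CollectI exI conjI) (rule refl assms)+

lemma isotope_classE:
  assumes "p \<in> isotope_class m"
  obtains \<gamma> \<delta> where "p = (pgl_class A \<gamma>, pgl_class A \<delta>)"
    "\<gamma> \<in> carrier (GL A)" "\<delta> \<in> carrier (GL A)" "proportional m (isotope A \<gamma> \<delta>)"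
proof -
  from assms have "\<exists>\<gamma> \<delta>. p = (pgl_class A \<gamma>, pgl_class A \<delta>) \<and>
      \<gamma> \<in> carrier (GL A) \<and> \<delta> \<in> carrier (GL A) \<and> proportional m (isotope A \<gamma> \<delta>)"
    unfolding isotope_class_def by (rule CollectD)
  with that show thesis by metis
qed

lemma isotope_class_eq_iff:
  assumes "m \<in> Ob (isotope_groupoid A)" "m' \<in> Ob (isotope_groupoid A)"
  shows "isotope_class m = isotope_class m' \<longleftrightarrow> proportional m m'"
proof
  assume eq: "isotope_class m = isotope_class m'"
  obtain \<alpha> \<beta> where \<alpha>: "\<alpha> \<in> carrier (GL A)" and \<beta>: "\<beta> \<in> carrier (GL A)" and m: "m = isotope A \<alpha> \<beta>"
    using assms(1) by (auto simp: isotope_groupoid_def)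
  have "(pgl_class A \<alpha>, pgl_class A \<beta>) \<in> isotope_class m'"
    unfolding eq[symmetric] m by (rule isotope_classI[OF \<alpha> \<beta> proportional_refl])
  then obtain \<gamma> \<delta> where \<gamma>: "pgl_class A \<gamma> = pgl_class A \<alpha>" and \<delta>: "pgl_class A \<delta> = pgl_class A \<beta>"
    and p: "proportional m' (isotope A \<gamma> \<delta>)"
    by (metis isotope_classE prod.inject)
  obtain c where c: "c \<noteq> 0" "\<gamma> = smul A c \<circ> \<alpha>" using \<gamma> by (rule pgl_class_eqD)
  obtain d where d: "d \<noteq> 0" "\<delta> = smul A d \<circ> \<beta>" using \<delta> by (rule pgl_class_eqD)
  from c d have "proportional m (isotope A \<gamma> \<delta>)"
    unfolding proportional_def m isotope_def
    by (auto simp: mul_smul_left mul_smul_right intro!: exI[of _ "d * c"])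
  with p show "proportional m m'" by (metis proportional_sym proportional_trans)
next
  assume "proportional m m'"
  then have "proportional m x \<longleftrightarrow> proportional m' x" for x
    by (metis proportional_sym proportional_trans)
  then show "isotope_class m = isotope_class m'"
    unfolding isotope_class_def by simp
qed

lemma nucleus_unit_maps_GL:
  assumes "w \<in> carrier (nucleus_units A)"
  shows "Rmul A w \<in> carrier (GL A)" "Lmul A w \<in> carrier (GL A)"
proof -
  obtain v where w: "w \<in> nucleus A" and vw: "v \<cdot> w = \<e>" and wv: "w \<cdot> v = \<e>"
    using assms by (auto simp: nucleus_units_iff)
  have 1: "(x \<cdot> w) \<cdot> v = x" "w \<cdot> (v \<cdot> x) = x" "(x \<cdot> v) \<cdot> w = x" for x
    using nucleusD(2)[OF w, of x v] nucleusD(1)[OF w, of v x] nucleusD(3)[OF w, of x v]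
    by (simp_all add: vw wv aone_left aone_right)
  then have R: "bij (\<lambda>x. x \<cdot> w)"
    by (intro o_bij[of "\<lambda>x. x \<cdot> v"]) (auto simp: fun_eq_iff)
  have "v \<cdot> (w \<cdot> x) = x" for x
  proof -
    have "v \<cdot> (w \<cdot> x) = (v \<cdot> w) \<cdot> x" by (simp add: nucleusD(2)[OF w])
    then show ?thesis by (simp add: vw aone_left)
  qed
  then have L: "bij (\<lambda>x. w \<cdot> x)"
    by (intro o_bij[of "\<lambda>x. v \<cdot> x"]) (auto simp: fun_eq_iff 1)
  show "Rmul A w \<in> carrier (GL A)" "Lmul A w \<in> carrier (GL A)"
    using R L by (auto simp: GL_iff Rmul_def Lmul_def mul_add_left mul_add_right mul_smul_left
        mul_smul_right)
qed

text \<open>With \<open>v = \<sigma>(1)\<close> and \<open>w = \<tau>(1)\<close>, the cases \<open>y = 1\<close> and \<open>x = 1\<close> of the hypothesis say that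
  \<open>R_w\<close> inverts \<open>\<sigma>\<close> and \<open>L_v\<close> inverts \<open>\<tau>\<close>; substituting this back gives \<open>(xw)(vy) = xy\<close>, from
  which \<open>L_v\<close> and \<open>L_w\<close> are mutually inverse and \<open>w\<close> lies in the middle nucleus.\<close>

lemma factorization_of_multiplication:
  assumes \<sigma>: "bij \<sigma>" and \<tau>: "bij \<tau>" and mul: "\<And>x y. \<sigma> x \<cdot> \<tau> y = x \<cdot> y"
  obtains w where "w \<in> carrier (nucleus_units A)" "\<And>x. \<sigma> x \<cdot> w = x" "\<And>y. \<tau> y = w \<cdot> y"
proof -
  define v w where "v = \<sigma> \<e>" and "w = \<tau> \<e>"
  have \<sigma>w: "\<sigma> x \<cdot> w = x" and v\<tau>: "v \<cdot> \<tau> x = x" for x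
    using mul[of x \<e>] mul[of \<e> x] by (simp_all add: v_def w_def aone_left aone_right)
  have \<sigma>': "\<sigma> (x \<cdot> w) = x" for x
    using \<sigma>w \<sigma> by (metis bij_pointE)
  have \<tau>': "\<tau> (v \<cdot> x) = x" for x
    using v\<tau> \<tau> by (metis bij_pointE)
  have "(x \<cdot> w) \<cdot> (v \<cdot> y) = x \<cdot> y" for x y
    using mul[of "x \<cdot> w" "v \<cdot> y"] by (simp add: \<sigma>' \<tau>')
  note xwvy = this
  have wv: "w \<cdot> (v \<cdot> y) = y" for y
    using xwvy[of \<e> y] by (simp add: aone_left)
  have \<tau>_eq: "\<tau> y = w \<cdot> y" for y
    using wv[of "\<tau> y"] by (simp add: v\<tau>)
  have vw: "v \<cdot> (w \<cdot> y) = y" for y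
    using v\<tau>[of y] by (simp add: \<tau>_eq)
  have "(x \<cdot> w) \<cdot> y = x \<cdot> (w \<cdot> y)" for x y
    using xwvy[of x "w \<cdot> y"] by (simp add: vw)
  then have "w \<in> nucleus A" by (rule nucleus_if_middle)
  moreover have "v \<cdot> w = \<e>" "w \<cdot> v = \<e>"
    using vw[of \<e>] wv[of \<e>] by (simp_all add: aone_right)
  ultimately have "w \<in> carrier (nucleus_units A)" by (auto simp: nucleus_units_iff)
  then show thesis using \<sigma>w \<tau>_eq by (rule that)
qed

theorem X_class_eq_isotope_class:
  assumes \<alpha>: "\<alpha> \<in> carrier (GL A)" and \<beta>: "\<beta> \<in> carrier (GL A)"
  shows "X_class A \<alpha> \<beta> = isotope_class (isotope A \<alpha> \<beta>)"
proof -
  have X_class: "X_class A \<alpha> \<beta> = {(pgl_class A (inv\<^bsub>GL A\<^esub> (Rmul A w) \<circ> \<alpha>), pgl_class A (Lmul A w \<circ> \<beta>))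
      | w. w \<in> carrier (nucleus_units A)}"
    unfolding X_class_def orbit_def
    by (rule Collect_cong, rule ex_cong1)
      (auto simp: nucleus_act_def PGL_mult GL_inv nucleus_unit_maps_GL)
  show ?thesis
  proof (intro Set.set_eqI iffI)
    fix p assume "p \<in> X_class A \<alpha> \<beta>"
    then obtain w where w: "w \<in> carrier (nucleus_units A)"
      and p: "p = (pgl_class A (inv\<^bsub>GL A\<^esub> (Rmul A w) \<circ> \<alpha>), pgl_class A (Lmul A w \<circ> \<beta>))"
      unfolding X_class by blast
    have n: "w \<in> nucleus A" using w by (simp add: nucleus_units_iff)
    have R: "Rmul A w \<in> carrier (GL A)" and L: "Lmul A w \<in> carrier (GL A)"
      using nucleus_unit_maps_GL[OF w] by auto
    have "(inv\<^bsub>GL A\<^esub> (Rmul A w)) x \<cdot> (w \<cdot> y) = x \<cdot> y" for x y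
      using GL_inv(2)[OF R, of x] by (simp add: nucleusD(2)[OF n, symmetric] Rmul_def)
    then have "isotope A (inv\<^bsub>GL A\<^esub> (Rmul A w) \<circ> \<alpha>) (Lmul A w \<circ> \<beta>) = isotope A \<alpha> \<beta>"
      by (simp add: isotope_def Lmul_def)
    then show "p \<in> isotope_class (isotope A \<alpha> \<beta>)"
      unfolding p by (intro isotope_classI GL_comp GL_inv R L \<alpha> \<beta>) (simp add: proportional_refl)
  next
    fix p assume "p \<in> isotope_class (isotope A \<alpha> \<beta>)"
    then obtain \<gamma> \<delta> where p: "p = (pgl_class A \<gamma>, pgl_class A \<delta>)"
      and \<gamma>: "\<gamma> \<in> carrier (GL A)" and \<delta>: "\<delta> \<in> carrier (GL A)"
      and "proportional (isotope A \<alpha> \<beta>) (isotope A \<gamma> \<delta>)"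
      by (rule isotope_classE)
    then obtain c where c: "c \<noteq> 0" and mul: "\<And>x y. \<gamma> x \<cdot> \<delta> y = smul A c (\<alpha> x \<cdot> \<beta> y)"
      unfolding proportional_def isotope_def by blast
    define \<sigma> where "\<sigma> = smul A (inverse c) \<circ> \<gamma> \<circ> inv\<^bsub>GL A\<^esub> \<alpha>"
    define \<tau> where "\<tau> = \<delta> \<circ> inv\<^bsub>GL A\<^esub> \<beta>"
    have "\<sigma> \<in> carrier (GL A)" "\<tau> \<in> carrier (GL A)"
      using \<alpha> \<beta> \<gamma> \<delta> c by (auto simp: \<sigma>_def \<tau>_def intro!: GL_comp GL_inv GL_smul)
    then have "bij \<sigma>" "bij \<tau>" by (auto dest: GL_D)
    moreover have "\<sigma> x \<cdot> \<tau> y = x \<cdot> y" for x y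
      using c by (simp add: \<sigma>_def \<tau>_def mul_smul_left mul GL_inv[OF \<alpha>] GL_inv[OF \<beta>])
    ultimately obtain w where w: "w \<in> carrier (nucleus_units A)"
      and \<sigma>w: "\<And>x. \<sigma> x \<cdot> w = x" and \<tau>w: "\<And>y. \<tau> y = w \<cdot> y"
      by (rule factorization_of_multiplication) blast
    have R: "Rmul A w \<in> carrier (GL A)" using nucleus_unit_maps_GL[OF w] by auto
    have \<sigma>_eq: "\<sigma> x = (inv\<^bsub>GL A\<^esub> (Rmul A w)) x" for x
      using GL_inv(3)[OF R, of "\<sigma> x"] by (simp add: Rmul_def \<sigma>w)
    have "\<gamma> x = smul A c (\<sigma> (\<alpha> x))" for x
      using c by (simp add: \<sigma>_def GL_inv[OF \<alpha>])
    then have "\<gamma> = smul A c \<circ> (inv\<^bsub>GL A\<^esub> (Rmul A w) \<circ> \<alpha>)"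
      by (simp add: fun_eq_iff \<sigma>_eq)
    then have "pgl_class A \<gamma> = pgl_class A (inv\<^bsub>GL A\<^esub> (Rmul A w) \<circ> \<alpha>)"
      by (simp add: pgl_class_smul c)
    moreover have "\<delta> x = \<tau> (\<beta> x)" for x
      by (simp add: \<tau>_def GL_inv[OF \<beta>])
    then have "\<delta> = Lmul A w \<circ> \<beta>"
      by (simp add: fun_eq_iff \<tau>w Lmul_def)
    ultimately show "p \<in> X_class A \<alpha> \<beta>"
      unfolding X_class p using w by blast
  qed
qed

lemma isotope_Ob:
  "\<alpha> \<in> carrier (GL A) \<Longrightarrow> \<beta> \<in> carrier (GL A) \<Longrightarrow> isotope A \<alpha> \<beta> \<in> Ob (isotope_groupoid A)"
  by (auto simp: isotope_groupoid_def)

lemma isotope_ObE: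
  assumes "m \<in> Ob (isotope_groupoid A)"
  obtains \<alpha> \<beta> where "\<alpha> \<in> carrier (GL A)" "\<beta> \<in> carrier (GL A)" "m = isotope A \<alpha> \<beta>"
  using assms by (auto simp: isotope_groupoid_def)

lemma X_set_eq: "X_set A = isotope_class ` Ob (isotope_groupoid A)"
proof -
  have "X_set A = {X_class A \<alpha> \<beta> | \<alpha> \<beta>. \<alpha> \<in> carrier (GL A) \<and> \<beta> \<in> carrier (GL A)}"
    by (auto simp: X_set_def orbits_def X_class_def carrier_PGL)
  also have "\<dots> = isotope_class ` Ob (isotope_groupoid A)"
    by (force simp: isotope_groupoid_def X_class_eq_isotope_class)
  finally show ?thesis .
qed


section \<open>The action by transport of structure\<close>

definition transport :: "('a \<Rightarrow> 'a) \<Rightarrow> ('a \<Rightarrow> 'a \<Rightarrow> 'a) \<Rightarrow> 'a \<Rightarrow> 'a \<Rightarrow> 'a" where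
  "transport \<phi> m = (\<lambda>x y. \<phi> (m ((inv\<^bsub>GL A\<^esub> \<phi>) x) ((inv\<^bsub>GL A\<^esub> \<phi>) y)))"

lemma transport_eq_iff:
  assumes "\<phi> \<in> carrier (GL A)"
  shows "transport \<phi> m = m' \<longleftrightarrow> (\<forall>x y. \<phi> (m x y) = m' (\<phi> x) (\<phi> y))"
  unfolding transport_def fun_eq_iff by (metis GL_inv(2,3)[OF assms])

lemma transport_id: "transport id m = m"
  by (simp add: transport_eq_iff GL_id)

lemma transport_comp:
  assumes "\<phi> \<in> carrier (GL A)" "\<psi> \<in> carrier (GL A)"
  shows "transport (\<phi> \<circ> \<psi>) m = transport \<phi> (transport \<psi> m)"
  using assms by (simp add: transport_eq_iff GL_comp) (simp add: transport_def GL_inv)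

lemma transport_proportional:
  assumes "\<phi> \<in> carrier (GL A)" "proportional m m'"
  shows "proportional (transport \<phi> m) (transport \<phi> m')"
  using assms by (auto simp: proportional_def transport_def GL_D)

text \<open>The value of \<open>m\<close> is multiplied by \<open>c\<close> and each of its two arguments by \<open>c\<^sup>-\<^sup>1\<close>, hence the
  inverse in total.\<close>

lemma transport_smul:
  assumes m: "m \<in> Ob (isotope_groupoid A)" and c: "c \<noteq> 0"
  shows "transport (smul A c) m = (\<lambda>x y. smul A (inverse c) (m x y))"
proof -
  obtain \<alpha> \<beta> where ab: "\<alpha> \<in> carrier (GL A)" "\<beta> \<in> carrier (GL A)" and m: "m = isotope A \<alpha> \<beta>"
    using m by (rule isotope_ObE)
  show ?thesis
    using c by (simp add: transport_eq_iff GL_smul m isotope_def GL_D[OF ab(1)] GL_D[OF ab(2)]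
        mul_smul_left mul_smul_right)
qed

lemma transport_isotope:
  assumes \<phi>: "\<phi> \<in> carrier (GL A)" and mul: "\<And>x y. \<phi> (x \<cdot> y) = \<phi>1 x \<cdot> \<phi>2 y"
  shows "transport \<phi> (isotope A \<alpha> \<beta>)
    = isotope A (\<phi>1 \<circ> \<alpha> \<circ> inv\<^bsub>GL A\<^esub> \<phi>) (\<phi>2 \<circ> \<beta> \<circ> inv\<^bsub>GL A\<^esub> \<phi>)"
  by (simp add: transport_def isotope_def mul)

lemma transport_Ob:
  assumes \<phi>: "\<phi> \<in> carrier (G_grp A)" and m: "m \<in> Ob (isotope_groupoid A)"
  shows "transport \<phi> m \<in> Ob (isotope_groupoid A)"
proof -
  obtain \<phi>1 \<phi>2 where f: "\<phi> \<in> carrier (GL A)" "\<phi>1 \<in> carrier (GL A)" "\<phi>2 \<in> carrier (GL A)"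
    "\<And>x y. \<phi> (x \<cdot> y) = \<phi>1 x \<cdot> \<phi>2 y"
    using G_grpE[OF \<phi>] by metis
  obtain \<alpha> \<beta> where ab: "\<alpha> \<in> carrier (GL A)" "\<beta> \<in> carrier (GL A)" and m: "m = isotope A \<alpha> \<beta>"
    using m by (rule isotope_ObE)
  show ?thesis
    unfolding m transport_isotope[OF f(1,4)] using f ab by (intro isotope_Ob GL_comp GL_inv)
qed

lemma transport_smul_comp:
  assumes \<phi>: "\<phi> \<in> carrier (G_grp A)" and m: "m \<in> Ob (isotope_groupoid A)" and c: "c \<noteq> 0"
  shows "transport (smul A c \<circ> \<phi>) m = (\<lambda>x y. smul A (inverse c) (transport \<phi> m x y))"
  using transport_Ob[OF \<phi> m]
  by (simp add: transport_comp GL_smul G_grp_GL[OF \<phi>] c transport_smul)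

text \<open>Independence of all choices is immediate here: changing \<open>\<phi>\<close> by a scalar, or the pair \<open>(\<alpha>, \<beta>)\<close>
  within its class, changes the multiplication \<open>\<phi>(m(\<phi>\<^sup>-\<^sup>1 x, \<phi>\<^sup>-\<^sup>1 y))\<close> only by a scalar, and the
  triality components do not occur in it.\<close>

theorem pg_act_isotope_class:
  assumes \<phi>: "\<phi> \<in> carrier (G_grp A)" and m: "m \<in> Ob (isotope_groupoid A)"
  shows "pg_act A (pg_class A \<phi>) (isotope_class m) = isotope_class (transport \<phi> m)"
  unfolding pg_act_def
proof (rule the_equality, goal_cases)
  case 1
  obtain \<phi>1 \<phi>2 where f: "\<phi> \<in> carrier (GL A)" "\<phi>1 \<in> carrier (GL A)" "\<phi>2 \<in> carrier (GL A)"
    "\<And>x y. \<phi> (x \<cdot> y) = \<phi>1 x \<cdot> \<phi>2 y" "triality_components A \<phi> \<phi>1 \<phi>2"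
    using G_grpE[OF \<phi>] by metis
  obtain \<alpha> \<beta> where ab: "\<alpha> \<in> carrier (GL A)" "\<beta> \<in> carrier (GL A)" and m: "m = isotope A \<alpha> \<beta>"
    using m by (rule isotope_ObE)
  have "isotope_class (transport \<phi> m)
      = X_class A (\<phi>1 \<circ> \<alpha> \<circ> inv\<^bsub>GL A\<^esub> \<phi>) (\<phi>2 \<circ> \<beta> \<circ> inv\<^bsub>GL A\<^esub> \<phi>)"
    using f ab by (simp add: m transport_isotope[OF f(1,4)] X_class_eq_isotope_class GL_comp GL_inv)
  moreover have "isotope_class m = X_class A \<alpha> \<beta>"
    using ab by (simp add: m X_class_eq_isotope_class)
  ultimately show ?case using \<phi> f(5) ab by blast
next
  case (2 Z)
  then obtain \<psi> \<psi>1 \<psi>2 \<alpha> \<beta> where \<psi>: "\<psi> \<in> carrier (G_grp A)" "pg_class A \<phi> = pg_class A \<psi>"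
      "triality_components A \<psi> \<psi>1 \<psi>2"
    and ab: "\<alpha> \<in> carrier (GL A)" "\<beta> \<in> carrier (GL A)" "isotope_class m = X_class A \<alpha> \<beta>"
    and Z: "Z = X_class A (\<psi>1 \<circ> \<alpha> \<circ> inv\<^bsub>GL A\<^esub> \<psi>) (\<psi>2 \<circ> \<beta> \<circ> inv\<^bsub>GL A\<^esub> \<psi>)"
    by blast
  have f: "\<psi> \<in> carrier (GL A)" "\<psi>1 \<in> carrier (GL A)" "\<psi>2 \<in> carrier (GL A)"
    "\<And>x y. \<psi> (x \<cdot> y) = \<psi>1 x \<cdot> \<psi>2 y"
    using \<psi> by (auto simp: triality_components_def GO_def G_grp_GL)
  have Z: "Z = isotope_class (transport \<psi> (isotope A \<alpha> \<beta>))"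
    using f ab by (simp add: Z transport_isotope[OF f(1,4)] X_class_eq_isotope_class GL_comp GL_inv)
  have "proportional m (isotope A \<alpha> \<beta>)"
    using ab m by (simp add: X_class_eq_isotope_class isotope_class_eq_iff isotope_Ob)
  then have 1: "proportional (transport \<psi> m) (transport \<psi> (isotope A \<alpha> \<beta>))"
    by (rule transport_proportional[OF f(1)])
  obtain c where "c \<noteq> 0" "\<phi> = smul A c \<circ> \<psi>"
    using \<psi>(2) unfolding pg_class_eq by (rule pgl_class_eqD)
  then have "proportional (transport \<psi> m) (transport \<phi> m)"
    unfolding proportional_def
    by (intro exI[of _ "inverse c"]) (simp add: transport_smul_comp[OF \<psi>(1) m])
  with 1 have "proportional (transport \<psi> (isotope A \<alpha> \<beta>)) (transport \<phi> m)"
    by (metis proportional_sym proportional_trans)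
  then show ?case
    unfolding Z by (simp add: isotope_class_eq_iff transport_Ob \<psi>(1) \<phi> m isotope_Ob ab)
qed


section \<open>The functor\<close>

lemma isotope_category: "category (isotope_groupoid A)"
  by unfold_locales (auto simp: isotope_groupoid_def GL_id GL_comp)

lemma X_groupoid_category: "category (X_groupoid A)"
proof
  fix x y z f g
  assume x: "x \<in> Ob (X_groupoid A)" and "f \<in> Hom (X_groupoid A) x y" "g \<in> Hom (X_groupoid A) y z"
  then obtain m \<phi> \<psi> where m: "m \<in> Ob (isotope_groupoid A)" "x = isotope_class m"
    and \<phi>: "\<phi> \<in> carrier (G_grp A)" "f = pg_class A \<phi>" "pg_act A f x = y"
    and \<psi>: "\<psi> \<in> carrier (G_grp A)" "g = pg_class A \<psi>" "pg_act A g y = z"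
    by (auto simp: X_groupoid_def action_groupoid_def X_set_eq carrier_PG)
  have "z = isotope_class (transport \<psi> (transport \<phi> m))"
    using m \<phi> \<psi> by (auto simp: pg_act_isotope_class transport_Ob)
  also have "\<dots> = pg_act A (pg_class A (\<psi> \<circ> \<phi>)) x"
    using m \<phi> \<psi> by (simp add: pg_act_isotope_class G_grp_comp transport_comp G_grp_GL)
  finally show "Cmp (X_groupoid A) g f \<in> Hom (X_groupoid A) x z"
    using \<phi> \<psi> by (auto simp: X_groupoid_def action_groupoid_def PG_mult carrier_PG G_grp_comp)
qed (auto simp: X_groupoid_def action_groupoid_def X_set_eq carrier_PG PG_one PG_mult G_grp_id
    G_grp_comp pg_act_isotope_class transport_id comp_assoc)

text \<open>An isomorphism \<open>\<phi>\<close> from \<open>A\<^bsub>\<alpha>,\<beta>\<^esub>\<close> to \<open>A\<^bsub>\<gamma>,\<delta>\<^esub>\<close> is the first member of the autotopy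
  \<open>(\<phi>, \<gamma>\<phi>\<alpha>\<^sup>-\<^sup>1, \<delta>\<phi>\<beta>\<^sup>-\<^sup>1)\<close> of \<open>A\<close>, hence a similitude with triality components.\<close>

lemma isotope_isomorphism_G_grp:
  assumes "m \<in> Ob (isotope_groupoid A)" "m' \<in> Ob (isotope_groupoid A)"
    and "\<phi> \<in> Hom (isotope_groupoid A) m m'"
  shows "\<phi> \<in> carrier (G_grp A)" "transport \<phi> m = m'"
proof -
  obtain \<alpha> \<beta> where ab: "\<alpha> \<in> carrier (GL A)" "\<beta> \<in> carrier (GL A)" and m: "m = isotope A \<alpha> \<beta>"
    using assms(1) by (rule isotope_ObE)
  obtain \<gamma> \<delta> where cd: "\<gamma> \<in> carrier (GL A)" "\<delta> \<in> carrier (GL A)" and m': "m' = isotope A \<gamma> \<delta>"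
    using assms(2) by (rule isotope_ObE)
  have \<phi>: "\<phi> \<in> carrier (GL A)" and iso: "\<And>x y. \<phi> (m x y) = m' (\<phi> x) (\<phi> y)"
    using assms(3) by (auto simp: isotope_groupoid_def)
  show "transport \<phi> m = m'" by (simp add: transport_eq_iff \<phi> iso)
  show "\<phi> \<in> carrier (G_grp A)"
  proof (rule triality_componentsI(1)[of _ "\<gamma> \<circ> \<phi> \<circ> inv\<^bsub>GL A\<^esub> \<alpha>" "\<delta> \<circ> \<phi> \<circ> inv\<^bsub>GL A\<^esub> \<beta>"])
    fix x y
    show "\<phi> (x \<cdot> y) = (\<gamma> \<circ> \<phi> \<circ> inv\<^bsub>GL A\<^esub> \<alpha>) x \<cdot> (\<delta> \<circ> \<phi> \<circ> inv\<^bsub>GL A\<^esub> \<beta>) y"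
      using iso[of "(inv\<^bsub>GL A\<^esub> \<alpha>) x" "(inv\<^bsub>GL A\<^esub> \<beta>) y"]
      by (simp add: m m' isotope_def GL_inv[OF ab(1)] GL_inv[OF ab(2)])
  qed (use \<phi> ab cd in \<open>auto intro!: GL_comp GL_inv\<close>)
qed

lemma isotope_HomI:
  assumes "\<phi> \<in> carrier (GL A)" "transport \<phi> m = m'"
  shows "\<phi> \<in> Hom (isotope_groupoid A) m m'"
  using assms by (simp add: isotope_groupoid_def transport_eq_iff)

lemma isotope_nontrivial:
  assumes "m \<in> Ob (isotope_groupoid A)"
  obtains x y where "m x y \<noteq> 0"
proof -
  obtain \<alpha> \<beta> where ab: "\<alpha> \<in> carrier (GL A)" "\<beta> \<in> carrier (GL A)" and m: "m = isotope A \<alpha> \<beta>"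
    using assms by (rule isotope_ObE)
  have "m ((inv\<^bsub>GL A\<^esub> \<alpha>) \<e>) ((inv\<^bsub>GL A\<^esub> \<beta>) \<e>) \<noteq> 0"
    by (simp add: m isotope_def GL_inv[OF ab(1)] GL_inv[OF ab(2)] aone_left one_neq_zero)
  then show thesis by (rule that)
qed

sublocale isotope_functor: cat_functor "isotope_groupoid A" "X_groupoid A" isotope_class
  "\<lambda>m m' \<phi>. pg_class A \<phi>"
proof (intro cat_functor.intro cat_functor_axioms.intro isotope_category X_groupoid_category)
  fix m assume "m \<in> Ob (isotope_groupoid A)"
  then show "isotope_class m \<in> Ob (X_groupoid A)"
    by (simp add: X_groupoid_def action_groupoid_def X_set_eq)
next
  fix m m' \<phi>
  assume m: "m \<in> Ob (isotope_groupoid A)" "m' \<in> Ob (isotope_groupoid A)"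
    and "\<phi> \<in> Hom (isotope_groupoid A) m m'"
  with isotope_isomorphism_G_grp[OF this]
  show "pg_class A \<phi> \<in> Hom (X_groupoid A) (isotope_class m) (isotope_class m')"
    by (auto simp: X_groupoid_def action_groupoid_def carrier_PG pg_act_isotope_class)
next
  fix m
  show "pg_class A (Idt (isotope_groupoid A) m) = Idt (X_groupoid A) (isotope_class m)"
    by (simp add: isotope_groupoid_def X_groupoid_def action_groupoid_def PG_one)
next
  fix x y z f g
  assume "x \<in> Ob (isotope_groupoid A)" "y \<in> Ob (isotope_groupoid A)" "z \<in> Ob (isotope_groupoid A)"
    "f \<in> Hom (isotope_groupoid A) x y" "g \<in> Hom (isotope_groupoid A) y z"
  then have "g \<in> carrier (G_grp A)"
    using isotope_isomorphism_G_grp(1) by blast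
  then show "pg_class A (Cmp (isotope_groupoid A) g f)
      = Cmp (X_groupoid A) (pg_class A g) (pg_class A f)"
    by (simp add: isotope_groupoid_def X_groupoid_def action_groupoid_def PG_mult)
qed

text \<open>Two isomorphisms \<open>m \<rightarrow> m'\<close> in the same class transport \<open>m\<close> to scalar multiples of each
  other, and these agree only if the scalar is \<open>1\<close>, because \<open>m'\<close> is not the zero multiplication.
  Conversely a class sending \<open>[m]\<close> to \<open>[m']\<close> has a representative that transports \<open>m\<close> to \<open>m'\<close>
  itself, by rescaling.\<close>

lemma isotope_functor_fully_faithful:
  assumes m: "m \<in> Ob (isotope_groupoid A)" and m': "m' \<in> Ob (isotope_groupoid A)"
  shows "bij_betw (pg_class A) (Hom (isotope_groupoid A) m m')
    (Hom (X_groupoid A) (isotope_class m) (isotope_class m'))"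
  unfolding bij_betw_def
proof (intro conjI inj_onI equalityI subsetI)
  fix \<phi> \<psi>
  assume \<phi>: "\<phi> \<in> Hom (isotope_groupoid A) m m'" and \<psi>: "\<psi> \<in> Hom (isotope_groupoid A) m m'"
    and eq: "pg_class A \<phi> = pg_class A \<psi>"
  obtain c where c: "c \<noteq> 0" and \<phi>_eq: "\<phi> = smul A c \<circ> \<psi>"
    using eq unfolding pg_class_eq by (rule pgl_class_eqD)
  have "m' = (\<lambda>x y. smul A (inverse c) (m' x y))"
    using transport_smul_comp[OF isotope_isomorphism_G_grp(1)[OF m m' \<psi>] m c]
      isotope_isomorphism_G_grp(2)[OF m m' \<phi>] isotope_isomorphism_G_grp(2)[OF m m' \<psi>]
    by (simp add: \<phi>_eq)
  then have scale: "m' x y = smul A (inverse c) (m' x y)" for x y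
    by (rule fun_cong[OF fun_cong])
  obtain x y where "m' x y \<noteq> 0" using m' by (rule isotope_nontrivial)
  with scale[of x y] have "inverse c = 1"
    by (metis scale_one scale_right_imp_eq)
  then show "\<phi> = \<psi>" by (simp add: \<phi>_eq fun_eq_iff)
next
  fix P assume "P \<in> pg_class A ` Hom (isotope_groupoid A) m m'"
  then show "P \<in> Hom (X_groupoid A) (isotope_class m) (isotope_class m')"
    using isotope_functor.Fa_in_Hom[OF m m'] by blast
next
  fix P assume "P \<in> Hom (X_groupoid A) (isotope_class m) (isotope_class m')"
  then obtain \<phi> where \<phi>: "\<phi> \<in> carrier (G_grp A)" "P = pg_class A \<phi>"
    and "isotope_class (transport \<phi> m) = isotope_class m'"
    using m by (auto simp: X_groupoid_def action_groupoid_def carrier_PG pg_act_isotope_class)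
  then have "proportional m' (transport \<phi> m)"
    using m m' by (simp add: isotope_class_eq_iff transport_Ob proportional_sym)
  then obtain c where c: "c \<noteq> 0" and eq: "\<And>x y. transport \<phi> m x y = smul A c (m' x y)"
    by (auto simp: proportional_def)
  have "transport (smul A c \<circ> \<phi>) m = m'"
    using c by (simp add: transport_smul_comp[OF \<phi>(1) m] eq)
  then have "smul A c \<circ> \<phi> \<in> Hom (isotope_groupoid A) m m'"
    by (intro isotope_HomI GL_comp GL_smul c G_grp_GL[OF \<phi>(1)])
  moreover have "pg_class A (smul A c \<circ> \<phi>) = P"
    by (simp add: \<phi>(2) pg_class_eq pgl_class_smul c)
  ultimately show "P \<in> pg_class A ` Hom (isotope_groupoid A) m m'" by blast
qed

lemma isotope_functor_equivalence:
  "cat_equivalence (isotope_groupoid A) (X_groupoid A) isotope_class (\<lambda>m m' \<phi>. pg_class A \<phi>)"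
proof (rule isotope_functor.cat_equivalence_if_fully_faithful_surjective)
  fix Y assume "Y \<in> Ob (X_groupoid A)"
  then show "\<exists>m\<in>Ob (isotope_groupoid A). isotope_class m = Y"
    by (auto simp: X_groupoid_def action_groupoid_def X_set_eq)
qed (rule isotope_functor_fully_faithful)

end

theorem theorem7:
  fixes A :: "('k::field, 'a::ab_group_add) normed_alg"
  assumes "hurwitz_algebra A"
  shows "\<exists>Fo Fa.
    cat_equivalence (isotope_groupoid A) (X_groupoid A) Fo Fa \<and>
    (\<forall>\<alpha>\<in>carrier (GL A). \<forall>\<beta>\<in>carrier (GL A). Fo (isotope A \<alpha> \<beta>) = X_class A \<alpha> \<beta>) \<and>
    (\<forall>m\<in>Ob (isotope_groupoid A). \<forall>m'\<in>Ob (isotope_groupoid A).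
      \<forall>\<phi>\<in>Hom (isotope_groupoid A) m m'. Fa m m' \<phi> = pg_class A \<phi>)"
proof -
  interpret hurwitz_algebra A by (rule assms)
  show ?thesis
    by (intro exI[of _ isotope_class] exI[of _ "\<lambda>m m' \<phi>. pg_class A \<phi>"])
      (simp add: isotope_functor_equivalence X_class_eq_isotope_class)
qed

end
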